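(* Let $(\mathfrak{g},[~,~]_\mathfrak{g},\alpha)$ and $(\mathfrak{h},[~,~]_\mathfrak{h},\beta)$ be two (multiplicative) Hom-Lie algebras. Then a linear map $\varphi:\mathfrak{g}\to\mathfrak{h}$ is a Hom-Lie algebra morphism if and only if $\varphi\in C^1_{\mathrm{Hom}}(\mathfrak{g},\mathfrak{h})$ and $\varphi$ is a Maurer-Cartan element in the differential graded Lie algebra $(C^\bullet_{\mathrm{Hom}}(\mathfrak{g},\mathfrak{h}),[~,~]_{\mathsf{C}},D)$.
   Context: All vector spaces and (multi)linear maps are over a field $\mathbf{k}$ of characteristic $0$. A (multiplicative) Hom-Lie algebra $(\mathfrak{g},[~,~],\alpha)$ is a vector space $\mathfrak{g}$ with a skew-symmetric bilinear map $[~,~]$ and a linear map $\alpha:\mathfrak{g}\to\mathfrak{g}$ such that $[\alpha(x),[y,z]]+[\alpha(y),[z,x]]+[\alpha(z),[x,y]]=0$ and $\alpha([x,y])=[\alpha(x),\alpha(y)]$. A morphism from $(\mathfrak{g},[~,~]_\mathfrak{g},\alpha)$ to $(\mathfrak{h},[~,~]_\mathfrak{h},\beta)$ is a linear map $\varphi$ with $\beta\circ\varphi=\varphi\circ\alpha$ and $\varphi([x,y]_\mathfrak{g})=[\varphi(x),\varphi(y)]_\mathfrak{h}$. For $n\ge 1$, $C^n_{\mathrm{Hom}}(\mathfrak{g},\mathfrak{h})=\{f:\wedge^n\mathfrak{g}\to\mathfrak{h}\mid \beta\circ f=f\circ\alpha^{\wedge n}\}$, in degree $n$, and $C^\bullet_{\mathrm{Hom}}(\mathfrak{g},\mathfrak{h})=\bigoplus_{n\ge1}C^n_{\mathrm{Hom}}(\mathfrak{g},\mathfrak{h})$.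 With $Sh(m,n)$ the set of $(m,n)$-shuffles, the cup product bracket is, for $P\in C^m_{\mathrm{Hom}}(\mathfrak{g},\mathfrak{h})$, $Q\in C^n_{\mathrm{Hom}}(\mathfrak{g},\mathfrak{h})$, $$[P,Q]_{\mathsf{C}}(x_1,\ldots,x_{m+n})=\sum_{\sigma\in Sh(m,n)}(-1)^\sigma[\beta^{n-1}P(x_{\sigma(1)},\ldots,x_{\sigma(m)}),\beta^{m-1}Q(x_{\sigma(m+1)},\ldots,x_{\sigma(m+n)})]_\mathfrak{h}.$$ The differential $D:C^n_{\mathrm{Hom}}(\mathfrak{g},\mathfrak{h})\to C^{n+1}_{\mathrm{Hom}}(\mathfrak{g},\mathfrak{h})$ is $$(Df)(x_1,\ldots,x_{n+1})=\sum_{1\le i<j\le n+1}(-1)^{i+j}f([x_i,x_j]_\mathfrak{g},\alpha(x_1),\ldots,\widehat{\alpha(x_i)},\ldots,\widehat{\alpha(x_j)},\ldots,\alpha(x_{n+1})).$$ The triple $(C^\bullet_{\mathrm{Hom}}(\mathfrak{g},\mathfrak{h}),[~,~]_{\mathsf{C}},D)$ is a differential graded Lie algebra. A Maurer-Cartan element of a differential graded Lie algebra $(\mathcal{L},[~,~],d)$ is $s\in\mathcal{L}^1$ with $ds+\frac12[s,s]=0$. *)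

theory Defs
  imports Complex_Main "HOL-Combinatorics.Permutations" "HOL-Library.Function_Algebras"
begin

section \<open>Multiplicative Hom-Lie algebras\<close>

locale hom_lie_algebra = vector_space scale
  for scale :: "'k::field_char_0 \<Rightarrow> 'a::ab_group_add \<Rightarrow> 'a" +
  fixes bracket :: "'a \<Rightarrow> 'a \<Rightarrow> 'a" and \<alpha> :: "'a \<Rightarrow> 'a"
  assumes bracket_linear_left: "Vector_Spaces.linear scale scale (\<lambda>x. bracket x y)"
    and bracket_linear_right: "Vector_Spaces.linear scale scale (\<lambda>y. bracket x y)"
    and bracket_skew: "bracket x y = - bracket y x"
    and twist_linear: "Vector_Spaces.linear scale scale \<alpha>"
    and hom_jacobi:
      "bracket (\<alpha> x) (bracket y z) + bracket (\<alpha> y) (bracket z x) + bracket (\<alpha> z) (bracket x y) = 0"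
    and twist_bracket: "\<alpha> (bracket x y) = bracket (\<alpha> x) (\<alpha> y)"

definition hom_lie_morphism ::
    "('k::field_char_0 \<Rightarrow> 'g::ab_group_add \<Rightarrow> 'g) \<Rightarrow> ('g \<Rightarrow> 'g \<Rightarrow> 'g) \<Rightarrow> ('g \<Rightarrow> 'g) \<Rightarrow>
     ('k \<Rightarrow> 'h::ab_group_add \<Rightarrow> 'h) \<Rightarrow> ('h \<Rightarrow> 'h \<Rightarrow> 'h) \<Rightarrow> ('h \<Rightarrow> 'h) \<Rightarrow> ('g \<Rightarrow> 'h) \<Rightarrow> bool" where
  "hom_lie_morphism sg brg \<alpha> sh brh \<beta> \<phi> \<longleftrightarrow>
     Vector_Spaces.linear sg sh \<phi> \<and> \<beta> \<circ> \<phi> = \<phi> \<circ> \<alpha> \<and>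
     (\<forall>x y. \<phi> (brg x y) = brh (\<phi> x) (\<phi> y))"


section \<open>Differential graded Lie algebras and Maurer-Cartan elements\<close>

text \<open>
  The underlying graded vector space is the internal direct sum of the subspaces \<open>L i\<close> of the
  ambient space \<open>'v\<close>; the ambient space may be larger, so all axioms are relative to \<open>total\<close>
  or to the homogeneous components.
\<close>

locale graded_subspaces = vector_space scale
  for scale :: "'k::field_char_0 \<Rightarrow> 'v::ab_group_add \<Rightarrow> 'v" +
  fixes L :: "int \<Rightarrow> 'v set"
  assumes subspace_component: "subspace (L i)"
    and direct_sum:
      "finite I \<Longrightarrow> (\<And>i. i \<in> I \<Longrightarrow> v i \<in> L i) \<Longrightarrow> (\<Sum>i\<in>I. v i) = 0 \<Longrightarrow> j \<in> I \<Longrightarrow> v j = 0"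
begin

definition total :: "'v set" where
  "total = span (\<Union>i. L i)"

end

locale dg_lie_algebra = graded_subspaces scale L
  for scale :: "'k::field_char_0 \<Rightarrow> 'v::ab_group_add \<Rightarrow> 'v" and L :: "int \<Rightarrow> 'v set" +
  fixes bracket :: "'v \<Rightarrow> 'v \<Rightarrow> 'v" and d :: "'v \<Rightarrow> 'v"
  assumes bracket_add_left: "x \<in> total \<Longrightarrow> y \<in> total \<Longrightarrow> z \<in> total \<Longrightarrow>
      bracket (x + y) z = bracket x z + bracket y z"
    and bracket_add_right: "x \<in> total \<Longrightarrow> y \<in> total \<Longrightarrow> z \<in> total \<Longrightarrow>
      bracket x (y + z) = bracket x y + bracket x z"
    and bracket_scale_left: "x \<in> total \<Longrightarrow> y \<in> total \<Longrightarrow>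
      bracket (scale c x) y = scale c (bracket x y)"
    and bracket_scale_right: "x \<in> total \<Longrightarrow> y \<in> total \<Longrightarrow>
      bracket x (scale c y) = scale c (bracket x y)"
    and d_add: "x \<in> total \<Longrightarrow> y \<in> total \<Longrightarrow> d (x + y) = d x + d y"
    and d_scale: "x \<in> total \<Longrightarrow> d (scale c x) = scale c (d x)"
    and bracket_degree: "x \<in> L i \<Longrightarrow> y \<in> L j \<Longrightarrow> bracket x y \<in> L (i + j)"
    and d_degree: "x \<in> L i \<Longrightarrow> d x \<in> L (i + 1)"
    and graded_skew: "x \<in> L i \<Longrightarrow> y \<in> L j \<Longrightarrow>
      bracket x y = - scale ((-1) powi (i * j)) (bracket y x)"
    and graded_jacobi: "x \<in> L i \<Longrightarrow> y \<in> L j \<Longrightarrow> z \<in> L k \<Longrightarrow>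
      bracket x (bracket y z) =
        bracket (bracket x y) z + scale ((-1) powi (i * j)) (bracket y (bracket x z))"
    and d_derivation: "x \<in> L i \<Longrightarrow> y \<in> L j \<Longrightarrow>
      d (bracket x y) = bracket (d x) y + scale ((-1) powi i) (bracket x (d y))"
    and d_squared: "x \<in> total \<Longrightarrow> d (d x) = 0"

text \<open>The Maurer-Cartan equation involves only the data of a differential graded Lie algebra.\<close>

definition maurer_cartan ::
    "('k::field_char_0 \<Rightarrow> 'v::ab_group_add \<Rightarrow> 'v) \<Rightarrow> (int \<Rightarrow> 'v set) \<Rightarrow> ('v \<Rightarrow> 'v \<Rightarrow> 'v) \<Rightarrow>
     ('v \<Rightarrow> 'v) \<Rightarrow> 'v \<Rightarrow> bool" where
  "maurer_cartan scale L bracket d s \<longleftrightarrow> s \<in> L 1 \<and> d s + scale (1 / 2) (bracket s s) = 0"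


section \<open>The complex of a pair of Hom-Lie algebras\<close>

text \<open>
  An \<open>n\<close>-linear map is a function on lists of length \<open>n\<close>, extended by \<open>0\<close> to lists of any other
  length. With this normalisation the spaces of cochains of different degrees are independent
  subspaces of the single space of functions on lists, and the degree \<open>n\<close> component
  of an element of their direct sum is its restriction to lists of length \<open>n\<close>. A linear map on the
  exterior power is an alternating multilinear map.
\<close>

definition alternating_multilinear ::
    "('k::field_char_0 \<Rightarrow> 'g::ab_group_add \<Rightarrow> 'g) \<Rightarrow> ('k \<Rightarrow> 'h::ab_group_add \<Rightarrow> 'h) \<Rightarrow> nat \<Rightarrow>
     ('g list \<Rightarrow> 'h) \<Rightarrow> bool" where
  "alternating_multilinear sg sh n f \<longleftrightarrow>
     (\<forall>xs. length xs \<noteq> n \<longrightarrow> f xs = 0) \<and>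
     (\<forall>xs i. length xs = n \<longrightarrow> i < n \<longrightarrow> Vector_Spaces.linear sg sh (\<lambda>x. f (xs[i := x]))) \<and>
     (\<forall>xs i j. length xs = n \<longrightarrow> i < j \<longrightarrow> j < n \<longrightarrow> xs ! i = xs ! j \<longrightarrow> f xs = 0)"

definition C_Hom ::
    "('k::field_char_0 \<Rightarrow> 'g::ab_group_add \<Rightarrow> 'g) \<Rightarrow> ('g \<Rightarrow> 'g) \<Rightarrow>
     ('k \<Rightarrow> 'h::ab_group_add \<Rightarrow> 'h) \<Rightarrow> ('h \<Rightarrow> 'h) \<Rightarrow> nat \<Rightarrow> ('g list \<Rightarrow> 'h) set" where
  "C_Hom sg \<alpha> sh \<beta> n =
     {f. alternating_multilinear sg sh n f \<and>
         (\<forall>xs. length xs = n \<longrightarrow> \<beta> (f xs) = f (map \<alpha> xs))}"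

definition C_Hom_graded ::
    "('k::field_char_0 \<Rightarrow> 'g::ab_group_add \<Rightarrow> 'g) \<Rightarrow> ('g \<Rightarrow> 'g) \<Rightarrow>
     ('k \<Rightarrow> 'h::ab_group_add \<Rightarrow> 'h) \<Rightarrow> ('h \<Rightarrow> 'h) \<Rightarrow> int \<Rightarrow> ('g list \<Rightarrow> 'h) set" where
  "C_Hom_graded sg \<alpha> sh \<beta> i = (if i \<ge> 1 then C_Hom sg \<alpha> sh \<beta> (nat i) else {0})"

definition cochain_scale ::
    "('k \<Rightarrow> 'h \<Rightarrow> 'h) \<Rightarrow> 'k \<Rightarrow> ('g list \<Rightarrow> 'h) \<Rightarrow> 'g list \<Rightarrow> 'h" where
  "cochain_scale sh c f = (\<lambda>xs. sh c (f xs))"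

text \<open>Permutations act on the positions \<open>0, \<dots>, m + n - 1\<close>.\<close>

definition Sh :: "nat \<Rightarrow> nat \<Rightarrow> (nat \<Rightarrow> nat) set" where
  "Sh m n = {\<sigma>. \<sigma> permutes {..<m + n} \<and> strict_mono_on {..<m} \<sigma> \<and> strict_mono_on {m..<m + n} \<sigma>}"

definition cup_bracket_component ::
    "('k::field_char_0 \<Rightarrow> 'h::ab_group_add \<Rightarrow> 'h) \<Rightarrow> ('h \<Rightarrow> 'h \<Rightarrow> 'h) \<Rightarrow> ('h \<Rightarrow> 'h) \<Rightarrow> nat \<Rightarrow> nat \<Rightarrow>
     ('g list \<Rightarrow> 'h) \<Rightarrow> ('g list \<Rightarrow> 'h) \<Rightarrow> 'g list \<Rightarrow> 'h" where
  "cup_bracket_component sh brh \<beta> m n P Q xs =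
     (\<Sum>\<sigma>\<in>Sh m n. sh (of_int (sign \<sigma>))
        (brh ((\<beta> ^^ (n - 1)) (P (map (\<lambda>i. xs ! \<sigma> i) [0..<m])))
             ((\<beta> ^^ (m - 1)) (Q (map (\<lambda>i. xs ! \<sigma> i) [m..<m + n])))))"

text \<open>
  The bilinear extension of the cup product bracket to the direct sum: the component of degree \<open>N\<close>
  collects all pairs of degrees \<open>m, n \<ge> 1\<close> with \<open>m + n = N\<close>. See
  \<open>cup_bracket_homogeneous\<close> below for its value on homogeneous elements.
\<close>

definition cup_bracket ::
    "('k::field_char_0 \<Rightarrow> 'h::ab_group_add \<Rightarrow> 'h) \<Rightarrow> ('h \<Rightarrow> 'h \<Rightarrow> 'h) \<Rightarrow> ('h \<Rightarrow> 'h) \<Rightarrow>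
     ('g list \<Rightarrow> 'h) \<Rightarrow> ('g list \<Rightarrow> 'h) \<Rightarrow> 'g list \<Rightarrow> 'h" where
  "cup_bracket sh brh \<beta> P Q xs =
     (\<Sum>m\<in>{1..<length xs}. cup_bracket_component sh brh \<beta> m (length xs - m) P Q xs)"

text \<open>
  Positions are counted from \<open>0\<close>, which does not change the parity of \<open>i + j\<close>. The formula raises
  the length by one, so it defines the differential on all degrees at once.
\<close>

definition hom_differential ::
    "('g \<Rightarrow> 'g \<Rightarrow> 'g) \<Rightarrow> ('g \<Rightarrow> 'g) \<Rightarrow> ('k::field_char_0 \<Rightarrow> 'h::ab_group_add \<Rightarrow> 'h) \<Rightarrow>
     ('g list \<Rightarrow> 'h) \<Rightarrow> 'g list \<Rightarrow> 'h" where
  "hom_differential brg \<alpha> sh f xs =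
     (\<Sum>(i, j)\<in>{(i, j). i < j \<and> j < length xs}.
        sh ((-1) ^ (i + j)) (f (brg (xs ! i) (xs ! j) # map \<alpha> (nths xs (- {i, j})))))"

text \<open>The identification of linear maps with alternating multilinear maps in one argument.\<close>

definition cochain_of_map :: "('g \<Rightarrow> 'h::zero) \<Rightarrow> 'g list \<Rightarrow> 'h" where
  "cochain_of_map \<phi> xs = (if length xs = 1 then \<phi> (hd xs) else 0)"

lemma cup_bracket_homogeneous:
  assumes h: "hom_lie_algebra sh brh \<beta>" and mn: "m \<ge> 1" "n \<ge> 1"
    and P: "P \<in> C_Hom sg \<alpha> sh \<beta> m" and Q: "Q \<in> C_Hom sg \<alpha> sh \<beta> n"
  shows "cup_bracket sh brh \<beta> P Q xs =
    (if length xs = m + n then cup_bracket_component sh brh \<beta> m n P Q xs else 0)"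
proof -
  interpret h: hom_lie_algebra sh brh \<beta> by (fact h)
  have lin0: "f 0 = 0" if "Vector_Spaces.linear sh sh f" for f
    using that by (meson Vector_Spaces.linear.axioms(3) module_hom.zero)
  have pow0: "(\<beta> ^^ k) 0 = 0" for k
    by (induction k) (simp_all add: lin0 h.twist_linear)
  have br0: "brh 0 y = 0" "brh y 0 = 0" for y
    using lin0[OF h.bracket_linear_left] lin0[OF h.bracket_linear_right] by auto
  have P0: "P ys = 0" if "length ys \<noteq> m" for ys
    using P that by (simp add: C_Hom_def alternating_multilinear_def)
  have Q0: "Q ys = 0" if "length ys \<noteq> n" for ys
    using Q that by (simp add: C_Hom_def alternating_multilinear_def)
  have zero: "cup_bracket_component sh brh \<beta> k (length xs - k) P Q xs = 0"
    if "k < length xs" "k \<noteq> m \<or> length xs - k \<noteq> n" for k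
  proof -
    have "P (map (\<lambda>i. xs ! \<sigma> i) [0..<k]) = 0 \<or> Q (map (\<lambda>i. xs ! \<sigma> i) [k..<length xs]) = 0" for \<sigma>
      using that P0[of "map (\<lambda>i. xs ! \<sigma> i) [0..<k]"] Q0[of "map (\<lambda>i. xs ! \<sigma> i) [k..<length xs]"]
      by auto
    then have "brh ((\<beta> ^^ a) (P (map (\<lambda>i. xs ! \<sigma> i) [0..<k])))
        ((\<beta> ^^ b) (Q (map (\<lambda>i. xs ! \<sigma> i) [k..<length xs]))) = 0" for \<sigma> a b
      by (metis pow0 br0)
    then show ?thesis
      unfolding cup_bracket_component_def using that by simp
  qed
  show ?thesis
  proof (cases "length xs = m + n")
    case True
    have "cup_bracket sh brh \<beta> P Q xs =
        (\<Sum>k\<in>{m}. cup_bracket_component sh brh \<beta> k (length xs - k) P Q xs)"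
      unfolding cup_bracket_def using mn True
      by (intro sum.mono_neutral_right) (use zero True in auto)
    then show ?thesis using True by simp
  next
    case False
    then show ?thesis
      unfolding cup_bracket_def by (auto intro!: sum.neutral zero)
  qed
qed

end

theory Submission
  imports Defs
begin

text \<open>
  A linear map \<open>\<phi>\<close>, regarded as a function on one-element lists, is automatically alternating and
  multilinear, so that it is a 1-cochain exactly when it intertwines the twists. For such a \<open>\<phi>\<close> both
  \<open>D \<phi>\<close> and \<open>[\<phi>, \<phi>]\<close> live in degree two. The only index pair in \<open>D \<phi> (x, y)\<close> has odd sum,
  so \<open>D \<phi> (x, y) = - \<phi> [x, y]\<close>; the two \<open>(1, 1)\<close>-shuffles contribute
  \<open>[\<phi> x, \<phi> y]\<close> and \<open>- [\<phi> y, \<phi> x]\<close>, which agree by skew-symmetry, so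
  \<open>[\<phi>, \<phi>] (x, y) = 2 [\<phi> x, \<phi> y]\<close>. The Maurer-Cartan equation therefore reads
  \<open>- \<phi> [x, y] + [\<phi> x, \<phi> y] = 0\<close>, which is compatibility with the brackets.
\<close>

lemma cochain_of_map_singleton [simp]: "cochain_of_map \<phi> [x] = \<phi> x"
  by (simp add: cochain_of_map_def)

lemma cochain_of_map_in_C_Hom_iff:
  assumes "Vector_Spaces.linear sg sh \<phi>"
  shows "cochain_of_map \<phi> \<in> C_Hom sg \<alpha> sh \<beta> 1 \<longleftrightarrow> \<beta> \<circ> \<phi> = \<phi> \<circ> \<alpha>"
proof -
  have "alternating_multilinear sg sh 1 (cochain_of_map \<phi>)"
    using assms by (auto simp: alternating_multilinear_def cochain_of_map_def length_Suc_conv)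
  then show ?thesis
    by (auto simp: C_Hom_def fun_eq_iff length_Suc_conv)
qed

lemma Sh_1_1: "Sh 1 1 = {id, transpose 0 1}"
proof -
  \<comment> \<open>Both blocks are single positions, where monotonicity is vacuous.\<close>
  have blocks: "{..<1 + 1 :: nat} = {0, 1}" "{..<1 :: nat} = {0}" "{1..<1 + 1 :: nat} = {1}"
    by auto
  have "Sh 1 1 = {\<sigma>. \<sigma> permutes {0, 1}}"
    unfolding Sh_def strict_mono_on_def blocks by auto
  then show ?thesis
    by (simp add: permutes_doubleton_iff set_eq_iff)
qed

lemma hom_differential_cochain_of_map:
  assumes "hom_lie_algebra sh brh \<beta>"
  shows "hom_differential brg \<alpha> sh (cochain_of_map \<phi>) xs =
    (if length xs = 2 then - \<phi> (brg (xs ! 0) (xs ! 1)) else 0)"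
proof -
  interpret h: hom_lie_algebra sh brh \<beta> by (fact assms)
  show ?thesis
  proof (cases "length xs = 2")
    case True
    then obtain x y where xs: "xs = [x, y]"
      by (auto simp: numeral_2_eq_2 length_Suc_conv)
    have pairs: "{(i, j). i < j \<and> j < length xs} = {(0, 1)}"
      by (auto simp: xs)
    have "nths xs (- {0, 1}) = []"
      by (simp add: xs nths_Cons)
    then show ?thesis
      unfolding hom_differential_def pairs by (simp add: xs)
  next
    case False
    \<comment> \<open>Removing two entries and prepending the bracket never leaves a list of length one.\<close>
    have "cochain_of_map \<phi> (brg (xs ! i) (xs ! j) # map \<alpha> (nths xs (- {i, j}))) = 0"
      if ij: "i < j" "j < length xs" for i j
    proof -
      have "{k. k < length xs \<and> k \<in> - {i, j}} = {..<length xs} - {i, j}" by blast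
      then have "length (nths xs (- {i, j})) = card ({..<length xs} - {i, j})"
        by (simp only: length_nths)
      also have "\<dots> = length xs - 2"
        using ij by (subst card_Diff_subset) auto
      finally have "length (nths xs (- {i, j})) \<noteq> 0"
        using ij False by linarith
      then show ?thesis
        by (simp add: cochain_of_map_def)
    qed
    then show ?thesis
      using False by (auto simp: hom_differential_def intro!: sum.neutral)
  qed
qed

lemma cup_bracket_cochain_of_map:
  assumes h: "hom_lie_algebra sh brh \<beta>"
    and C: "cochain_of_map \<phi> \<in> C_Hom sg \<alpha> sh \<beta> 1"
  shows "cup_bracket sh brh \<beta> (cochain_of_map \<phi>) (cochain_of_map \<phi>) xs =
    (if length xs = 2 then sh 2 (brh (\<phi> (xs ! 0)) (\<phi> (xs ! 1))) else 0)"
proof -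
  interpret h: hom_lie_algebra sh brh \<beta> by (fact h)
  let ?b = "\<lambda>x y. brh (\<phi> x) (\<phi> y)"
  have "(id :: nat \<Rightarrow> nat) \<noteq> transpose 0 1"
    by (metis id_apply transpose_apply_first zero_neq_one)
  then have "cup_bracket_component sh brh \<beta> 1 1 (cochain_of_map \<phi>) (cochain_of_map \<phi>) xs =
      ?b (xs ! 0) (xs ! 1) - ?b (xs ! 1) (xs ! 0)"
    by (simp add: cup_bracket_component_def Sh_1_1[unfolded One_nat_def] sign_id sign_swap_id)
  also have "\<dots> = ?b (xs ! 0) (xs ! 1) + ?b (xs ! 0) (xs ! 1)"
    using h.bracket_skew[of "\<phi> (xs ! 0)" "\<phi> (xs ! 1)"] by simp
  also have "\<dots> = sh 2 (?b (xs ! 0) (xs ! 1))"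
    using h.scale_left_distrib[of 1 1] by simp
  finally show ?thesis
    using cup_bracket_homogeneous[OF h order_refl order_refl C C, of xs] by (simp add: numeral_2_eq_2)
qed

theorem proposition3p3:
  fixes sg :: "'k::field_char_0 \<Rightarrow> 'g::ab_group_add \<Rightarrow> 'g"
    and sh :: "'k \<Rightarrow> 'h::ab_group_add \<Rightarrow> 'h"
    and brg :: "'g \<Rightarrow> 'g \<Rightarrow> 'g" and brh :: "'h \<Rightarrow> 'h \<Rightarrow> 'h"
    and \<alpha> :: "'g \<Rightarrow> 'g" and \<beta> :: "'h \<Rightarrow> 'h" and \<phi> :: "'g \<Rightarrow> 'h"
  assumes "hom_lie_algebra sg brg \<alpha>"
    and "hom_lie_algebra sh brh \<beta>"
    and "Vector_Spaces.linear sg sh \<phi>"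
  shows "hom_lie_morphism sg brg \<alpha> sh brh \<beta> \<phi> \<longleftrightarrow>
    cochain_of_map \<phi> \<in> C_Hom sg \<alpha> sh \<beta> 1 \<and>
    maurer_cartan (cochain_scale sh) (C_Hom_graded sg \<alpha> sh \<beta>)
      (cup_bracket sh brh \<beta>) (hom_differential brg \<alpha> sh) (cochain_of_map \<phi>)"
proof -
  interpret h: hom_lie_algebra sh brh \<beta> by (fact assms(2))
  let ?f = "cochain_of_map \<phi>"
  let ?MC = "hom_differential brg \<alpha> sh ?f + cochain_scale sh (1 / 2) (cup_bracket sh brh \<beta> ?f ?f)"
  have MC_iff: "?MC = 0 \<longleftrightarrow> (\<forall>x y. \<phi> (brg x y) = brh (\<phi> x) (\<phi> y))"
    if C: "?f \<in> C_Hom sg \<alpha> sh \<beta> 1"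
  proof -
    have eval: "?MC xs =
      (if length xs = 2 then brh (\<phi> (xs ! 0)) (\<phi> (xs ! 1)) - \<phi> (brg (xs ! 0) (xs ! 1)) else 0)" for xs
      by (simp add: cochain_scale_def hom_differential_cochain_of_map[OF assms(2)]
          cup_bracket_cochain_of_map[OF assms(2) C])
    show ?thesis
    proof
      assume "?MC = 0"
      then have "?MC [x, y] = 0" for x y by simp
      then show "\<forall>x y. \<phi> (brg x y) = brh (\<phi> x) (\<phi> y)"
        unfolding eval by simp
    next
      assume "\<forall>x y. \<phi> (brg x y) = brh (\<phi> x) (\<phi> y)"
      then show "?MC = 0"
        by (intro ext) (simp only: eval, simp)
    qed
  qed
  show ?thesis
    using MC_iff assms(3) cochain_of_map_in_C_Hom_iff[OF assms(3), of \<alpha> \<beta>]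
    by (auto simp: hom_lie_morphism_def maurer_cartan_def C_Hom_graded_def)
qed

end
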